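(* Let $k$ be a field, $R=k[X_1,\dots,X_n]$ with the standard $\mathbb Z^n$-grading, and let $A$ be a monomial matrix with cogenerator degrees $(\alpha_i)_{i\in I}$ and generator degrees $(\beta_j)_{j\in J}$ ($I,J$ finite), representing a free-cofree presentation $\varphi_A$ of a module $M$. Consider the following procedure: going through the elements $j$ of (the original) $J$ one after the other, if $L(\operatorname{trunc}(A,j),A_j)\neq\emptyset$ for the current matrix $A$, then replace $A$ by the monomial matrix obtained from it by removing the column $A_j$ (together with its generator degree $\beta_j$); otherwise leave $A$ unchanged. After all $j$ have been treated, return the current matrix as $\tilde A$. Then the returned monomial matrix $\tilde A$ represents a free-cofree presentation of the same module $M$, and $\tilde A$ is generator-minimal.
   Context: The standard grading on $R=k[X_1,\dots,X_n]$ is the $\mathbb Z^n$-grading with $R=\bigoplus_{\alpha\in\mathbb N^n}kX^\alpha$; $\mathfrak m=(X_1,\dots,X_n)$. $\mathbb Z^n$ carries the componentwise partial order $\le$. All modules are $\mathbb Z^n$-graded, $(\Sigma^gM)_a=M_{a-g}$, and $R^\vee=\hom_R(R,E(k))$ is the Matlis dual of $R$, where $E(k)$ is the graded injective hull of $k=R/\mathfrak m$ and $\hom_R(M,N)=\bigoplus_a\operatorname{Hom}_R(\Sigma^aM,N)$ with $\operatorname{Hom}_R$ the graded degree-$0$ homomorphisms. Concretely, $R^\vee$ has a copy of $k$ in each degree of $-\mathbb N^n$ and is $0$ in all other degrees; $X^\beta$ acts from degree $a$ to degree $a+\beta$ as the identity of $k$ if $a+\beta\in-\mathbb N^n$ and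 as $0$ otherwise. A flat-injective presentation for $M$ is a graded degree-$0$ homomorphism $\varphi\colon F\to E$ with $F$ graded flat, $E$ graded injective and $\operatorname{Im}\varphi\cong M$; it is free-cofree if $F$ is graded free and $E$ is cofree, i.e. the Matlis dual of a graded free module. It is generator-minimal if $\operatorname{Ker}\varphi\subseteq\mathfrak mF$. A monomial matrix with cogenerator degrees $(\alpha_i)_{i\in I}$ and generator degrees $(\beta_j)_{j\in J}$ in $\mathbb Z^n$ is a matrix $A=(a_{ij})$ over $k$ with $a_{ij}=0$ unless $\alpha_i\ge\beta_j$. It represents the graded homomorphism $\varphi_A\colon\bigoplus_j\Sigma^{\beta_j}R\to\bigoplus_i\Sigma^{\alpha_i}R^\vee$ of degree $0$ sending the canonical basis element $e_j$ (of degree $\beta_j$) to the element whose $i$-th component is $a_{ij}\in k=(\Sigma^{\alpha_i}R^\vee)_{\beta_j}$ if $\beta_j\le\alpha_i$, and $0$ otherwise. $A$ is called generator-minimal if $\varphi_A$ is. $A_j$ denotes the $j$-th column of $A$. For a matrix $B\in k^{r\times s}$ and $b\in k^r$, $L(B,b)=\{x\in k^s\mid Bx=b\}$. For $j_0\in J$, the truncation $\operatorname{trunc}(A,j_0)$ is the matrix $(c_{ij'})_{i\in I,\,j'\in J'}$ with $J'=\{j\in J\mid\beta_j\le\beta_{j_0}\}\setminus\{j_0\}$ (where $J$ is the index set of columns of the matrix $A$ at hand), where, as intended, the column $c_{\bullet j'}$ consists of the coefficients of $X^{\beta_{j_0}-\beta_{j'}}\cdot\varphi_A(e_{j'})$,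 i.e. $c_{ij'}=a_{ij'}$ if $\beta_{j_0}\le\alpha_i$, and $c_{ij'}=0$ otherwise. *)

theory Defs
  imports "HOL-Algebra.Algebraic_Closure_Type"
    "HOL-Library.Poly_Mapping" "HOL-Library.Function_Algebras"
begin

text \<open>
  The variables are indexed by a finite type 'n. Exponents are functions 'n => nat and degrees are
  functions 'n => int, with the pointwise operations and the pointwise order.
\<close>

type_synonym 'n degree = "'n \<Rightarrow> int"
type_synonym ('n, 'k) mpoly = "('n \<Rightarrow> nat) \<Rightarrow>\<^sub>0 'k"

abbreviation poly_ring :: "('n, 'k::field) mpoly ring" where
  "poly_ring \<equiv> ring_of_type_algebra"

definition mdeg :: "('n \<Rightarrow> nat) \<Rightarrow> 'n degree" where
  "mdeg \<beta> = (\<lambda>i. int (\<beta> i))"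

definition poly_comp :: "'n degree \<Rightarrow> ('n, 'k::field) mpoly set" where
  "poly_comp a = {p. \<forall>\<beta>\<in>Poly_Mapping.keys p. mdeg \<beta> = a}"

definition indet :: "'n \<Rightarrow> ('n, 'k::field) mpoly" where
  "indet i = Poly_Mapping.single (\<lambda>j. if j = i then 1 else 0) 1"

definition irrelevant_ideal :: "('n, 'k::field) mpoly set" where
  "irrelevant_ideal = genideal poly_ring (range indet)"


section \<open>Graded modules\<close>

text \<open>
  The fields \<open>mult\<close> and \<open>one\<close>, which modules inherit from the ring record, are ignored by the
  locale \<open>module\<close>.
\<close>

record ('n, 'k, 'm) graded_module = "(('n, 'k) mpoly, 'm) module" +
  gcomp :: "'n degree \<Rightarrow> 'm set"

text \<open>\<open>poly_comp a\<close> is zero unless \<open>a\<close> is an exponent, so the third condition concerns only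
  \<open>a \<ge> 0\<close>; the last one says that \<open>M\<close> is the direct sum of its components.\<close>

definition is_graded_module :: "('n::finite, 'k::field, 'm) graded_module \<Rightarrow> bool" where
  "is_graded_module M \<longleftrightarrow>
     module poly_ring M \<and>
     (\<forall>a. additive_subgroup (gcomp M a) M) \<and>
     (\<forall>a b. \<forall>p\<in>poly_comp a. \<forall>x\<in>gcomp M b. p \<odot>\<^bsub>M\<^esub> x \<in> gcomp M (a + b)) \<and>
     (\<forall>x\<in>carrier M. \<exists>!c. (\<forall>a. c a \<in> gcomp M a) \<and> finite {a. c a \<noteq> \<zero>\<^bsub>M\<^esub>} \<and>
        x = finsum M c {a. c a \<noteq> \<zero>\<^bsub>M\<^esub>})"

definition shift :: "'n degree \<Rightarrow> ('n, 'k, 'm) graded_module \<Rightarrow> ('n, 'k, 'm) graded_module" where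
  "shift g M = M\<lparr>gcomp := (\<lambda>a. gcomp M (a - g))\<rparr>"

text \<open>Homogeneous \<open>R\<close>-linear maps of degree 0; only the values on \<open>carrier M\<close> matter.\<close>

definition graded_hom ::
  "('n, 'k::field, 'm) graded_module \<Rightarrow> ('n, 'k, 'l) graded_module \<Rightarrow> ('m \<Rightarrow> 'l) \<Rightarrow> bool" where
  "graded_hom M N f \<longleftrightarrow>
     f \<in> carrier M \<rightarrow> carrier N \<and>
     (\<forall>x\<in>carrier M. \<forall>y\<in>carrier M. f (x \<oplus>\<^bsub>M\<^esub> y) = f x \<oplus>\<^bsub>N\<^esub> f y) \<and>
     (\<forall>p. \<forall>x\<in>carrier M. f (p \<odot>\<^bsub>M\<^esub> x) = p \<odot>\<^bsub>N\<^esub> f x) \<and>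
     (\<forall>a. f ` gcomp M a \<subseteq> gcomp N a)"

definition graded_iso ::
  "('n, 'k::field, 'm) graded_module \<Rightarrow> ('n, 'k, 'l) graded_module \<Rightarrow> bool" where
  "graded_iso M N \<longleftrightarrow> (\<exists>f. graded_hom M N f \<and> bij_betw f (carrier M) (carrier N))"

definition image_module ::
  "('n, 'k, 'm) graded_module \<Rightarrow> ('n, 'k, 'l) graded_module \<Rightarrow> ('m \<Rightarrow> 'l) \<Rightarrow>
   ('n, 'k, 'l) graded_module" where
  "image_module M N f =
     N\<lparr>carrier := f ` carrier M, gcomp := (\<lambda>a. f ` carrier M \<inter> gcomp N a)\<rparr>"

definition direct_sum ::
  "'i set \<Rightarrow> ('i \<Rightarrow> ('n, 'k, 'm) graded_module) \<Rightarrow> ('n, 'k, 'i \<Rightarrow> 'm) graded_module" where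
  "direct_sum I M =
     \<lparr>carrier = {x \<in> PiE I (\<lambda>i. carrier (M i)). finite {i\<in>I. x i \<noteq> \<zero>\<^bsub>M i\<^esub>}},
      monoid.mult = undefined, monoid.one = undefined,
      ring.zero = (\<lambda>i\<in>I. \<zero>\<^bsub>M i\<^esub>),
      add = (\<lambda>x y. \<lambda>i\<in>I. x i \<oplus>\<^bsub>M i\<^esub> y i),
      module.smult = (\<lambda>p x. \<lambda>i\<in>I. p \<odot>\<^bsub>M i\<^esub> x i),
      gcomp = (\<lambda>a. {x \<in> PiE I (\<lambda>i. gcomp (M i) a). finite {i\<in>I. x i \<noteq> \<zero>\<^bsub>M i\<^esub>}})\<rparr>"

definition ideal_smult ::
  "('n, 'k) mpoly set \<Rightarrow> ('n, 'k, 'm) graded_module \<Rightarrow> 'm set" where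
  "ideal_smult I M = generate (add_monoid M) {p \<odot>\<^bsub>M\<^esub> x | p x. p \<in> I \<and> x \<in> carrier M}"


section \<open>Free and cofree modules\<close>

definition regular_module :: "('n, 'k::field, ('n, 'k) mpoly) graded_module" where
  "regular_module =
     \<lparr>carrier = UNIV, monoid.mult = (*), monoid.one = 1, ring.zero = 0, add = (+), module.smult = (*),
      gcomp = poly_comp\<rparr>"

text \<open>
  The concrete description of the Matlis dual of \<open>R\<close>, which is also the graded injective hull
  \<open>E(k)\<close>: the key of a basis element is its degree, an element of \<open>-\<nat>\<^sup>n\<close>.
\<close>

definition dual_smult ::
  "('n, 'k::field) mpoly \<Rightarrow> ('n degree \<Rightarrow>\<^sub>0 'k) \<Rightarrow> ('n degree \<Rightarrow>\<^sub>0 'k)" where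
  "dual_smult p f =
     (\<Sum>\<beta>\<in>Poly_Mapping.keys p. \<Sum>a\<in>Poly_Mapping.keys f.
        if a + mdeg \<beta> \<le> 0
        then Poly_Mapping.single (a + mdeg \<beta>) (Poly_Mapping.lookup p \<beta> * Poly_Mapping.lookup f a)
        else 0)"

definition dual_regular_module :: "('n, 'k::field, 'n degree \<Rightarrow>\<^sub>0 'k) graded_module" where
  "dual_regular_module =
     \<lparr>carrier = {f. \<forall>a\<in>Poly_Mapping.keys f. a \<le> 0},
      monoid.mult = undefined, monoid.one = undefined, ring.zero = 0, add = (+), module.smult = dual_smult,
      gcomp = (\<lambda>a. {f. Poly_Mapping.keys f \<subseteq> {a} \<inter> {..0}})\<rparr>"

definition std_free ::
  "'j set \<Rightarrow> ('j \<Rightarrow> 'n degree) \<Rightarrow> ('n, 'k::field, 'j \<Rightarrow> ('n, 'k) mpoly) graded_module" where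
  "std_free J \<beta> = direct_sum J (\<lambda>j. shift (\<beta> j) regular_module)"

definition std_cofree ::
  "'i set \<Rightarrow> ('i \<Rightarrow> 'n degree) \<Rightarrow> ('n, 'k::field, 'i \<Rightarrow> ('n degree \<Rightarrow>\<^sub>0 'k)) graded_module" where
  "std_cofree I \<alpha> = direct_sum I (\<lambda>i. shift (\<alpha> i) dual_regular_module)"

text \<open>
  The graded \<open>hom_R(M, N)\<close>: inside all \<open>R\<close>-linear maps, the (internal direct) sum over the degrees
  \<open>a\<close> of the graded homomorphisms from \<open>shift a M\<close> to \<open>N\<close>.
\<close>

definition hom_comp ::
  "('n, 'k::field, 'm) graded_module \<Rightarrow> ('n, 'k, 'l) graded_module \<Rightarrow> 'n degree \<Rightarrow>
   ('m \<Rightarrow> 'l) set" where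
  "hom_comp M N a = {f \<in> extensional (carrier M). graded_hom (shift a M) N f}"

definition hom_module ::
  "('n, 'k::field, 'm) graded_module \<Rightarrow> ('n, 'k, 'l) graded_module \<Rightarrow>
   ('n, 'k, 'm \<Rightarrow> 'l) graded_module" where
  "hom_module M N =
     \<lparr>carrier = {f. \<exists>D g. finite D \<and> (\<forall>a\<in>D. g a \<in> hom_comp M N a) \<and>
                      f = (\<lambda>x\<in>carrier M. finsum N (\<lambda>a. g a x) D)},
      monoid.mult = undefined, monoid.one = undefined,
      ring.zero = (\<lambda>x\<in>carrier M. \<zero>\<^bsub>N\<^esub>),
      add = (\<lambda>f g. \<lambda>x\<in>carrier M. f x \<oplus>\<^bsub>N\<^esub> g x),
      module.smult = (\<lambda>p f. \<lambda>x\<in>carrier M. p \<odot>\<^bsub>N\<^esub> f x),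
      gcomp = hom_comp M N\<rparr>"

definition matlis_dual ::
  "('n, 'k::field, 'm) graded_module \<Rightarrow>
   ('n, 'k, 'm \<Rightarrow> ('n degree \<Rightarrow>\<^sub>0 'k)) graded_module" where
  "matlis_dual M = hom_module M dual_regular_module"

text \<open>
  In the next two definitions the (possibly infinite) index set of the homogeneous basis is taken
  inside the module itself. This is no restriction: a basis of a free module indexes itself, and
  in the Matlis dual of a free module every basis element yields a different element of the dual
  basis.
\<close>

definition graded_free :: "('n, 'k::field, 'm) graded_module \<Rightarrow> bool" where
  "graded_free F \<longleftrightarrow> (\<exists>(J :: 'm set) \<beta>. graded_iso F (std_free J \<beta>))"

definition cofree :: "('n, 'k::field, 'm) graded_module \<Rightarrow> bool" where
  "cofree E \<longleftrightarrow> (\<exists>(J :: 'm set) \<beta>. graded_iso E (matlis_dual (std_free J \<beta>)))"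


section \<open>Free-cofree presentations\<close>

definition free_cofree_presentation ::
  "('n::finite, 'k::field, 'f) graded_module \<Rightarrow> ('n, 'k, 'e) graded_module \<Rightarrow> ('f \<Rightarrow> 'e) \<Rightarrow>
   ('n, 'k, 'm) graded_module \<Rightarrow> bool" where
  "free_cofree_presentation F E \<phi> M \<longleftrightarrow>
     is_graded_module F \<and> is_graded_module E \<and> is_graded_module M \<and>
     graded_free F \<and> cofree E \<and> graded_hom F E \<phi> \<and> graded_iso (image_module F E \<phi>) M"

definition generator_minimal ::
  "('n, 'k::field, 'f) graded_module \<Rightarrow> ('n, 'k, 'e) graded_module \<Rightarrow> ('f \<Rightarrow> 'e) \<Rightarrow> bool" where
  "generator_minimal F E \<phi> \<longleftrightarrow> a_kernel F E \<phi> \<subseteq> ideal_smult irrelevant_ideal F"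


section \<open>Monomial matrices\<close>

text \<open>Entries outside \<open>rows \<times> cols\<close> and degrees outside \<open>rows\<close>, \<open>cols\<close> are irrelevant.\<close>

record ('i, 'j, 'k) indexed_matrix =
  rows :: "'i set"
  cols :: "'j set"
  entry :: "'i \<Rightarrow> 'j \<Rightarrow> 'k"

record ('i, 'j, 'n, 'k) graded_matrix = "('i, 'j, 'k) indexed_matrix" +
  cogen_deg :: "'i \<Rightarrow> 'n degree"
  gen_deg :: "'j \<Rightarrow> 'n degree"

definition monomial_matrix :: "('i, 'j, 'n::finite, 'k::field) graded_matrix \<Rightarrow> bool" where
  "monomial_matrix A \<longleftrightarrow> finite (rows A) \<and> finite (cols A) \<and>
     (\<forall>i\<in>rows A. \<forall>j\<in>cols A. \<not> gen_deg A j \<le> cogen_deg A i \<longrightarrow> entry A i j = 0)"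

definition free_of ::
  "('i, 'j, 'n, 'k::field) graded_matrix \<Rightarrow> ('n, 'k, 'j \<Rightarrow> ('n, 'k) mpoly) graded_module" where
  "free_of A = std_free (cols A) (gen_deg A)"

definition cofree_of ::
  "('i, 'j, 'n, 'k::field) graded_matrix \<Rightarrow> ('n, 'k, 'i \<Rightarrow> ('n degree \<Rightarrow>\<^sub>0 'k)) graded_module" where
  "cofree_of A = std_cofree (rows A) (cogen_deg A)"

text \<open>
  The image of \<open>e\<^sub>j\<close>. The component of degree \<open>\<beta>\<^sub>j\<close> of the dual of \<open>R\<close> shifted by \<open>\<alpha>\<^sub>i\<close> is the
  component of degree \<open>\<beta>\<^sub>j - \<alpha>\<^sub>i\<close> of the dual of \<open>R\<close>.
\<close>

definition gen_image ::
  "('i, 'j, 'n, 'k::field) graded_matrix \<Rightarrow> 'j \<Rightarrow> 'i \<Rightarrow> ('n degree \<Rightarrow>\<^sub>0 'k)" where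
  "gen_image A j = (\<lambda>i\<in>rows A. if gen_deg A j \<le> cogen_deg A i
     then Poly_Mapping.single (gen_deg A j - cogen_deg A i) (entry A i j) else 0)"

definition matrix_hom ::
  "('i, 'j, 'n, 'k::field) graded_matrix \<Rightarrow> ('j \<Rightarrow> ('n, 'k) mpoly) \<Rightarrow>
   ('i \<Rightarrow> ('n degree \<Rightarrow>\<^sub>0 'k))" where
  "matrix_hom A f = finsum (cofree_of A) (\<lambda>j. f j \<odot>\<^bsub>cofree_of A\<^esub> gen_image A j) (cols A)"

definition represents_presentation ::
  "('i, 'j, 'n::finite, 'k::field) graded_matrix \<Rightarrow> ('n, 'k, 'm) graded_module \<Rightarrow> bool" where
  "represents_presentation A M \<longleftrightarrow>
     free_cofree_presentation (free_of A) (cofree_of A) (matrix_hom A) M"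

definition generator_minimal_matrix :: "('i, 'j, 'n, 'k::field) graded_matrix \<Rightarrow> bool" where
  "generator_minimal_matrix A \<longleftrightarrow> generator_minimal (free_of A) (cofree_of A) (matrix_hom A)"

definition solution_set ::
  "('i, 'j, 'k::field) indexed_matrix \<Rightarrow> ('i \<Rightarrow> 'k) \<Rightarrow> ('j \<Rightarrow> 'k) set" where
  "solution_set B b = {x \<in> cols B \<rightarrow>\<^sub>E UNIV. \<forall>i\<in>rows B. (\<Sum>j\<in>cols B. entry B i j * x j) = b i}"

definition trunc ::
  "('i, 'j, 'n, 'k::field) graded_matrix \<Rightarrow> 'j \<Rightarrow> ('i, 'j, 'k) indexed_matrix" where
  "trunc A j0 =
     \<lparr>rows = rows A,
      cols = {j\<in>cols A. gen_deg A j \<le> gen_deg A j0} - {j0},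
      entry = (\<lambda>i j. if gen_deg A j0 \<le> cogen_deg A i then entry A i j else 0)\<rparr>"

definition remove_col ::
  "'j \<Rightarrow> ('i, 'j, 'n, 'k) graded_matrix \<Rightarrow> ('i, 'j, 'n, 'k) graded_matrix" where
  "remove_col j A = A\<lparr>cols := cols A - {j}\<rparr>"

definition reduce_step ::
  "'j \<Rightarrow> ('i, 'j, 'n, 'k::field) graded_matrix \<Rightarrow> ('i, 'j, 'n, 'k) graded_matrix" where
  "reduce_step j A =
     (if solution_set (trunc A j) (\<lambda>i. entry A i j) \<noteq> {} then remove_col j A else A)"

definition reduce ::
  "'j list \<Rightarrow> ('i, 'j, 'n, 'k::field) graded_matrix \<Rightarrow> ('i, 'j, 'n, 'k) graded_matrix" where
  "reduce js A = fold reduce_step js A"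

end

theory Submission
  imports Defs
begin

text \<open>
  In the degree \<open>\<beta>\<^sub>j\<close>, the module \<open>F\<close> without its summand \<open>j\<close> is spanned by the elements
  \<open>X\<^bsup>\<beta>\<^sub>j - \<beta>\<^sub>l\<^esup> e\<^sub>l\<close> with \<open>l \<noteq> j\<close> and \<open>\<beta>\<^sub>l \<le> \<beta>\<^sub>j\<close>, and the columns of \<open>trunc A j\<close> are their images under
  \<open>\<phi>\<^sub>A\<close>. Hence the linear system of \<open>trunc A j\<close> with right-hand side \<open>A\<^sub>j\<close> is solvable iff
  \<open>\<phi>\<^sub>A(e\<^sub>j)\<close> lies in the image of the other summands. Both claims of the theorem rest on this.

  Preservation. If the system is solvable, then the column \<open>j\<close> can be removed without a change of
  the image as a set (\<open>image_remove_col\<close>): a solution \<open>x\<close> allows every \<open>e\<^sub>j\<close> to be replaced by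
  \<open>\<Sum>\<^sub>l x\<^sub>l X\<^bsup>\<beta>\<^sub>j - \<beta>\<^sub>l\<^esup> e\<^sub>l\<close>. The cofree module \<open>E\<close> stays the same, and the smaller \<open>F\<close> is again
  graded and free (\<open>graded_std_free\<close>, \<open>graded_free_std_free\<close>), so the smaller matrix represents a
  presentation of the same module (\<open>represents_presentation_remove_col\<close>).

  Minimality. Suppose that a kernel element \<open>f\<close> has a component \<open>f\<^sub>j\<close> with constant coefficient
  \<open>c \<noteq> 0\<close>. The part of the equation \<open>\<phi>\<^sub>A(f) = 0\<close> in degree \<open>\<beta>\<^sub>j\<close> expresses \<open>c \<phi>\<^sub>A(e\<^sub>j)\<close> through the
  images of the other summands; after division by \<open>c\<close> it is a solution of the system at \<open>j\<close>. So if
  no column has a solvable system, then all components of kernel elements have constant coefficient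
  zero, that is, lie in the irrelevant ideal (\<open>generator_minimal_matrixI\<close>). One pass over the
  columns reaches this situation because unsolvability persists: a solution for a matrix with fewer
  columns, extended by zero, is a solution for the larger one (\<open>solution_set_remove_col\<close>).
\<close>

section \<open>Polynomials\<close>

text \<open>
  The inverse of \<open>mdeg\<close> on the degrees \<open>a \<ge> 0\<close>. Where \<open>a i < 0\<close> the value is a meaningless \<open>0\<close>, so uses
  of \<open>expo a\<close> come with a condition that makes \<open>a\<close> nonnegative.
\<close>

abbreviation expo :: "'n degree \<Rightarrow> ('n \<Rightarrow> nat)" where
  "expo a \<equiv> \<lambda>i. nat (a i)"

lemma mdeg_nonneg: "0 \<le> mdeg \<gamma>"
  by (simp add: mdeg_def le_fun_def)

lemma expo_mdeg [simp]: "expo (mdeg \<gamma>) = \<gamma>"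
  by (simp add: mdeg_def)

lemma mdeg_expo: "0 \<le> a \<Longrightarrow> mdeg (expo a) = a"
  by (auto simp add: mdeg_def le_fun_def)

lemma mdeg_eq_iff: "mdeg \<gamma> = a \<longleftrightarrow> 0 \<le> a \<and> \<gamma> = expo a"
  using mdeg_nonneg mdeg_expo by (metis expo_mdeg)

lemma mdeg_plus: "mdeg (\<gamma> + \<delta>) = mdeg \<gamma> + mdeg \<delta>"
  by (auto simp: mdeg_def)

lemma sum_single_keys:
  fixes p :: "'a \<Rightarrow>\<^sub>0 'b::comm_monoid_add"
  shows "(\<Sum>\<gamma>\<in>Poly_Mapping.keys p. Poly_Mapping.single \<gamma> (Poly_Mapping.lookup p \<gamma>)) = p"
  by (rule poly_mapping_eqI) (simp add: lookup_sum lookup_single when_def in_keys_iff)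

lemma lookup_times_single:
  fixes p :: "('n, 'k::field) mpoly"
  shows "Poly_Mapping.lookup (p * Poly_Mapping.single \<delta> c) \<gamma> =
    (if \<delta> \<le> \<gamma> then Poly_Mapping.lookup p (\<lambda>i. \<gamma> i - \<delta> i) * c else 0)"
proof -
  have "p * Poly_Mapping.single \<delta> c =
      (\<Sum>\<epsilon>\<in>Poly_Mapping.keys p. Poly_Mapping.single (\<epsilon> + \<delta>) (Poly_Mapping.lookup p \<epsilon> * c))"
    by (subst sum_single_keys[of p, symmetric]) (simp add: sum_distrib_right mult_single)
  hence *: "Poly_Mapping.lookup (p * Poly_Mapping.single \<delta> c) \<gamma> =
      (\<Sum>\<epsilon>\<in>Poly_Mapping.keys p. if \<epsilon> + \<delta> = \<gamma> then Poly_Mapping.lookup p \<epsilon> * c else 0)"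
    by (simp add: lookup_sum lookup_single when_def)
  have **: "\<epsilon> + \<delta> = \<gamma> \<longleftrightarrow> \<delta> \<le> \<gamma> \<and> \<epsilon> = (\<lambda>i. \<gamma> i - \<delta> i)" for \<epsilon> :: "'n \<Rightarrow> nat"
  proof
    assume "\<epsilon> + \<delta> = \<gamma>"
    hence "\<gamma> i = \<epsilon> i + \<delta> i" for i by auto
    thus "\<delta> \<le> \<gamma> \<and> \<epsilon> = (\<lambda>i. \<gamma> i - \<delta> i)"
      by (simp add: le_fun_def)
  next
    assume "\<delta> \<le> \<gamma> \<and> \<epsilon> = (\<lambda>i. \<gamma> i - \<delta> i)" thus "\<epsilon> + \<delta> = \<gamma>"
      by (auto simp: le_fun_def fun_eq_iff)
  qed
  show ?thesis
    unfolding * ** by (simp add: in_keys_iff)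
qed

lemma poly_ring_simps [simp]:
  "carrier poly_ring = UNIV" "add poly_ring = (+)" "monoid.mult poly_ring = (*)"
  "monoid.one poly_ring = 1" "ring.zero poly_ring = 0"
  by (auto simp: ring_of_type_algebra_def)

lemma poly_ring_cring: "cring (poly_ring :: ('n, 'k::field) mpoly ring)"
  by (rule cring_from_type_algebra)

lemma poly_comp_zero [simp]: "0 \<in> poly_comp a"
  by (simp add: poly_comp_def)

lemma poly_comp_add: "p \<in> poly_comp a \<Longrightarrow> q \<in> poly_comp a \<Longrightarrow> p + q \<in> poly_comp a"
  using keys_add[of p q] by (auto simp: poly_comp_def)

lemma poly_comp_uminus: "p \<in> poly_comp a \<Longrightarrow> - p \<in> poly_comp a"
  by (auto simp: poly_comp_def in_keys_iff)

lemma poly_comp_mult: "p \<in> poly_comp a \<Longrightarrow> q \<in> poly_comp b \<Longrightarrow> p * q \<in> poly_comp (a + b)"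
  using keys_mult[of p q] by (fastforce simp: poly_comp_def mdeg_plus)

definition homogeneous_part :: "'n degree \<Rightarrow> ('n, 'k::field) mpoly \<Rightarrow> ('n, 'k) mpoly" where
  "homogeneous_part a p = (if 0 \<le> a then Poly_Mapping.single (expo a) (Poly_Mapping.lookup p (expo a)) else 0)"

lemma lookup_homogeneous_part:
  "Poly_Mapping.lookup (homogeneous_part a p) \<gamma> = (if mdeg \<gamma> = a then Poly_Mapping.lookup p \<gamma> else 0)"
  by (auto simp: homogeneous_part_def lookup_single when_def mdeg_eq_iff)

lemma homogeneous_part_in: "homogeneous_part a p \<in> poly_comp a"
  by (auto simp: poly_comp_def in_keys_iff lookup_homogeneous_part split: if_splits)

text \<open>
  Every monomial of \<open>p\<close> has a nonzero exponent, hence is a multiple of some variable.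
\<close>

lemma irrelevant_idealI:
  fixes p :: "('n::finite, 'k::field) mpoly"
  assumes "Poly_Mapping.lookup p 0 = 0"
  shows "p \<in> irrelevant_ideal"
proof -
  interpret R: cring "poly_ring :: ('n, 'k) mpoly ring" by (rule poly_ring_cring)
  have id: "ideal (irrelevant_ideal :: ('n, 'k) mpoly set) poly_ring"
    unfolding irrelevant_ideal_def by (rule R.genideal_ideal) simp
  interpret I: ideal "irrelevant_ideal :: ('n, 'k) mpoly set" poly_ring by (rule id)
  have gen: "indet i \<in> (irrelevant_ideal :: ('n, 'k) mpoly set)" for i
    using R.genideal_self[of "range indet"] by (auto simp: irrelevant_ideal_def)
  have mono: "Poly_Mapping.single \<gamma> c \<in> (irrelevant_ideal :: ('n, 'k) mpoly set)"
    if "\<gamma> \<noteq> 0" for \<gamma> :: "'n \<Rightarrow> nat" and c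
  proof -
    have "\<exists>i. \<gamma> i \<noteq> 0" using that by (simp add: fun_eq_iff)
    then obtain i where i: "\<gamma> i > 0" by auto
    define \<delta> where "\<delta> = (\<lambda>j. if j = i then \<gamma> j - 1 else \<gamma> j)"
    have "\<delta> + (\<lambda>j. if j = i then 1 else 0) = \<gamma>" using i by (auto simp: \<delta>_def fun_eq_iff)
    hence "Poly_Mapping.single \<gamma> c = Poly_Mapping.single \<delta> c * indet i"
      by (simp add: indet_def mult_single)
    thus ?thesis using I.I_l_closed[OF gen[of i], of "Poly_Mapping.single \<delta> c"] by simp
  qed
  have sums: "(\<Sum>\<gamma>\<in>S. Poly_Mapping.single \<gamma> (Poly_Mapping.lookup p \<gamma>)) \<in> irrelevant_ideal"
    if "finite S" "0 \<notin> S" for S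
    using that
  proof (induction S rule: finite_induct)
    case empty
    show ?case using I.zero_closed by simp
  next
    case (insert \<gamma> S)
    have "\<gamma> \<noteq> 0" "0 \<notin> S" using insert.prems by blast+
    from I.a_closed[OF mono[OF this(1)] insert.IH[OF this(2)], of "Poly_Mapping.lookup p \<gamma>"]
    show ?case using insert.hyps by simp
  qed
  show ?thesis
    using sums[of "Poly_Mapping.keys p"] assms by (simp add: sum_single_keys in_keys_iff)
qed


section \<open>Finite direct sums of shifted copies of the ring\<close>

text \<open>
  The only information on \<open>G\<close> is its zero and its addition, so that the lemma serves both for free
  modules, whose coordinates are polynomials, and for cofree ones, whose coordinates are elements of
  the dual of the ring.
\<close>

lemma finsum_coordinatewise:
  fixes c :: "'s \<Rightarrow> 'i \<Rightarrow> 'b::comm_monoid_add"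
  assumes "abelian_monoid G"
    and add: "add G = (\<lambda>x y. \<lambda>i\<in>I. x i + y i)" and zero: "ring.zero G = (\<lambda>i\<in>I. 0)"
    and c: "c \<in> S \<rightarrow> carrier G" and "finite S"
  shows "finsum G c S = (\<lambda>i\<in>I. \<Sum>s\<in>S. c s i)"
proof -
  interpret abelian_monoid G by fact
  show ?thesis
    using \<open>finite S\<close> c
  proof (induction S rule: finite_induct)
    case empty
    show ?case by (simp add: zero)
  next
    case (insert s S)
    thus ?case by (simp add: finsum_insert Pi_def) (simp add: add fun_eq_iff restrict_def)
  qed
qed

definition std_basis :: "'j set \<Rightarrow> 'j \<Rightarrow> 'j \<Rightarrow> ('n, 'k::field) mpoly" where
  "std_basis J j = (\<lambda>j'\<in>J. if j' = j then 1 else 0)"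

lemma inj_std_basis: "inj_on (std_basis J :: _ \<Rightarrow> _ \<Rightarrow> ('n, 'k::field) mpoly) J"
proof (rule inj_onI)
  fix j j' assume j: "j \<in> J" and "j' \<in> J"
    and "std_basis J j = (std_basis J j' :: _ \<Rightarrow> ('n, 'k) mpoly)"
  hence "std_basis J j j = (std_basis J j' j :: ('n, 'k) mpoly)" by simp
  thus "j = j'" using j by (simp add: std_basis_def split: if_splits)
qed

context
  fixes J :: "'j set" and \<beta> :: "'j \<Rightarrow> 'n::finite degree"
  assumes fin: "finite J"
begin

lemma std_free_simps:
  "carrier (std_free J \<beta> :: ('n, 'k::field, _) graded_module) = (J \<rightarrow>\<^sub>E UNIV)"
  "add (std_free J \<beta> :: ('n, 'k::field, _) graded_module) = (\<lambda>x y. \<lambda>j\<in>J. x j + y j)"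
  "ring.zero (std_free J \<beta> :: ('n, 'k::field, _) graded_module) = (\<lambda>j\<in>J. 0)"
  "module.smult (std_free J \<beta> :: ('n, 'k::field, _) graded_module) = (\<lambda>p x. \<lambda>j\<in>J. p * x j)"
  "gcomp (std_free J \<beta> :: ('n, 'k::field, _) graded_module) a = (\<Pi>\<^sub>E j\<in>J. poly_comp (a - \<beta> j))"
  using fin by (auto simp: std_free_def direct_sum_def shift_def regular_module_def)

lemma module_std_free: "module poly_ring (std_free J \<beta> :: ('n, 'k::field, _) graded_module)"
proof (rule moduleI)
  show "abelian_group (std_free J \<beta> :: ('n, 'k::field, _) graded_module)"
  proof (rule abelian_groupI)
    fix x assume x: "x \<in> carrier (std_free J \<beta> :: ('n, 'k::field, _) graded_module)"
    show "\<exists>y\<in>carrier (std_free J \<beta>). y \<oplus>\<^bsub>std_free J \<beta>\<^esub> x = \<zero>\<^bsub>std_free J \<beta>\<^esub>"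
      by (rule bexI[of _ "\<lambda>j\<in>J. - x j"]) (auto simp: std_free_simps)
  qed (auto simp: std_free_simps fun_eq_iff PiE_iff extensional_def algebra_simps)
qed (auto simp: std_free_simps fun_eq_iff PiE_iff extensional_def algebra_simps poly_ring_cring)

text \<open>
  The homogeneous decomposition of \<open>x\<close> is forced: since \<open>e\<^sub>j\<close> has degree \<open>\<beta>\<^sub>j\<close>, the component of degree
  \<open>a\<close> must have the part of degree \<open>a - \<beta>\<^sub>j\<close> of the polynomial \<open>x\<^sub>j\<close> as its \<open>j\<close>-th coordinate.
\<close>

lemma graded_std_free: "is_graded_module (std_free J \<beta> :: ('n, 'k::field, _) graded_module)"
proof -
  let ?F = "std_free J \<beta> :: ('n, 'k::field, _) graded_module"
  interpret F: module poly_ring ?F by (rule module_std_free)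
  have sub: "additive_subgroup (gcomp ?F a) ?F" for a
  proof -
    have "(\<lambda>j\<in>J. 0) \<in> gcomp ?F a" by (simp add: std_free_simps)
    moreover have "gcomp ?F a \<subseteq> carrier ?F"
      by (auto simp: std_free_simps)
    moreover have "\<ominus>\<^bsub>?F\<^esub> x \<in> gcomp ?F a" if x: "x \<in> gcomp ?F a" for x
    proof -
      have c: "x \<in> carrier ?F" using x by (auto simp: std_free_simps)
      have d: "(\<lambda>j\<in>J. - x j) \<in> carrier ?F" by (simp add: std_free_simps)
      have "\<ominus>\<^bsub>?F\<^esub> x = (\<lambda>j\<in>J. - x j)"
        by (rule F.minus_equality[OF _ c d]) (auto simp: std_free_simps)
      thus ?thesis
        using x by (auto simp: std_free_simps intro!: poly_comp_uminus)
    qed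
    moreover have "x \<oplus>\<^bsub>?F\<^esub> y \<in> gcomp ?F a" if "x \<in> gcomp ?F a" "y \<in> gcomp ?F a" for x y
      using that by (auto simp: std_free_simps intro!: poly_comp_add)
    ultimately show ?thesis
      by (intro additive_subgroup.intro F.add.subgroupI) (auto simp: a_inv_def)
  qed
  have smult: "p \<odot>\<^bsub>?F\<^esub> x \<in> gcomp ?F (a + b)" if "p \<in> poly_comp a" "x \<in> gcomp ?F b" for a b p x
    using that by (auto simp: std_free_simps add_diff_eq[symmetric] intro!: poly_comp_mult)
  have dec: "\<exists>!c. (\<forall>a. c a \<in> gcomp ?F a) \<and> finite {a. c a \<noteq> \<zero>\<^bsub>?F\<^esub>} \<and>
        x = finsum ?F c {a. c a \<noteq> \<zero>\<^bsub>?F\<^esub>}" if x: "x \<in> carrier ?F" for x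
  proof
    let ?c = "\<lambda>a. \<lambda>j\<in>J. homogeneous_part (a - \<beta> j) (x j)"
    have c_in: "?c a \<in> gcomp ?F a" for a by (simp add: std_free_simps homogeneous_part_in)
    have supp: "{a. ?c a \<noteq> \<zero>\<^bsub>?F\<^esub>} = (\<Union>j\<in>J. (\<lambda>\<gamma>. mdeg \<gamma> + \<beta> j) ` Poly_Mapping.keys (x j))"
    proof -
      have "?c a \<noteq> \<zero>\<^bsub>?F\<^esub> \<longleftrightarrow> (\<exists>j\<in>J. \<exists>\<gamma>\<in>Poly_Mapping.keys (x j). mdeg \<gamma> + \<beta> j = a)" for a
      proof -
        have "?c a = \<zero>\<^bsub>?F\<^esub> \<longleftrightarrow> (\<forall>j\<in>J. homogeneous_part (a - \<beta> j) (x j) = 0)"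
          by (auto simp: std_free_simps fun_eq_iff restrict_def)
        also have "\<dots> \<longleftrightarrow> (\<forall>j\<in>J. \<forall>\<gamma>. mdeg \<gamma> = a - \<beta> j \<longrightarrow> Poly_Mapping.lookup (x j) \<gamma> = 0)"
          by (auto simp: poly_mapping_eq_iff fun_eq_iff lookup_homogeneous_part)
        finally show ?thesis unfolding Bex_def in_keys_iff eq_diff_eq by blast
      qed
      thus ?thesis by (simp only: set_eq_iff mem_Collect_eq UN_iff image_iff eq_commute simp_thms)
    qed
    hence finc: "finite {a. ?c a \<noteq> \<zero>\<^bsub>?F\<^esub>}" using fin by simp
    have "finsum ?F ?c {a. ?c a \<noteq> \<zero>\<^bsub>?F\<^esub>} = (\<lambda>j\<in>J. \<Sum>a | ?c a \<noteq> \<zero>\<^bsub>?F\<^esub>. ?c a j)"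
      by (rule finsum_coordinatewise)
         (auto simp: F.abelian_monoid_axioms finc, auto simp: std_free_simps)
    also have "\<dots> = x"
    proof
      fix j
      show "(\<lambda>j\<in>J. \<Sum>a | ?c a \<noteq> \<zero>\<^bsub>?F\<^esub>. ?c a j) j = x j"
      proof (cases "j \<in> J")
        case True
        have "(\<Sum>a | ?c a \<noteq> \<zero>\<^bsub>?F\<^esub>. ?c a j) = x j"
        proof (rule poly_mapping_eqI)
          fix \<gamma>
          have "Poly_Mapping.lookup (\<Sum>a | ?c a \<noteq> \<zero>\<^bsub>?F\<^esub>. ?c a j) \<gamma> =
              (\<Sum>a | ?c a \<noteq> \<zero>\<^bsub>?F\<^esub>. if a = mdeg \<gamma> + \<beta> j then Poly_Mapping.lookup (x j) \<gamma> else 0)"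
            using True by (auto simp: lookup_sum lookup_homogeneous_part eq_diff_eq intro!: sum.cong)
          also have "\<dots> = Poly_Mapping.lookup (x j) \<gamma>"
            using True finc unfolding supp by (force simp: in_keys_iff)
          finally show "Poly_Mapping.lookup (\<Sum>a | ?c a \<noteq> \<zero>\<^bsub>?F\<^esub>. ?c a j) \<gamma> = \<dots>" .
        qed
        thus ?thesis using True by simp
      qed (use x in \<open>auto simp: std_free_simps\<close>)
    qed
    finally show "(\<forall>a. ?c a \<in> gcomp ?F a) \<and> finite {a. ?c a \<noteq> \<zero>\<^bsub>?F\<^esub>} \<and>
        x = finsum ?F ?c {a. ?c a \<noteq> \<zero>\<^bsub>?F\<^esub>}"
      using c_in finc by simp
    fix c assume c: "(\<forall>a. c a \<in> gcomp ?F a) \<and> finite {a. c a \<noteq> \<zero>\<^bsub>?F\<^esub>} \<and>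
        x = finsum ?F c {a. c a \<noteq> \<zero>\<^bsub>?F\<^esub>}"
    have c_carr: "c a \<in> carrier ?F" for a
      using c by (auto simp: std_free_simps PiE_iff)
    have xc: "x = (\<lambda>j\<in>J. \<Sum>a | c a \<noteq> \<zero>\<^bsub>?F\<^esub>. c a j)"
      using c
      by (subst finsum_coordinatewise[symmetric, where G = ?F])
         (auto simp: F.abelian_monoid_axioms c_carr, auto simp: std_free_simps)
    show "c = ?c"
    proof (rule ext, rule ext)
      fix a j
      show "c a j = ?c a j"
      proof (cases "j \<in> J")
        case True
        have hom: "Poly_Mapping.lookup (c a j) \<gamma> = 0" if "mdeg \<gamma> + \<beta> j \<noteq> a" for a \<gamma>
        proof -
          have "c a j \<in> poly_comp (a - \<beta> j)" using c True by (auto simp: std_free_simps)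
          thus ?thesis using that by (auto simp: poly_comp_def in_keys_iff)
        qed
        have "c a j = homogeneous_part (a - \<beta> j) (x j)"
        proof (rule poly_mapping_eqI)
          fix \<gamma>
          show "Poly_Mapping.lookup (c a j) \<gamma> = Poly_Mapping.lookup (homogeneous_part (a - \<beta> j) (x j)) \<gamma>"
          proof (cases "mdeg \<gamma> + \<beta> j = a")
            case a: True
            have "Poly_Mapping.lookup (x j) \<gamma> = (\<Sum>a | c a \<noteq> \<zero>\<^bsub>?F\<^esub>. Poly_Mapping.lookup (c a j) \<gamma>)"
              using True by (subst xc) (simp add: lookup_sum)
            also have "\<dots> = (\<Sum>b | c b \<noteq> \<zero>\<^bsub>?F\<^esub>. if b = a then Poly_Mapping.lookup (c a j) \<gamma> else 0)"
              by (rule sum.cong) (use hom a in auto)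
            also have "\<dots> = Poly_Mapping.lookup (c a j) \<gamma>"
              using c True by (auto simp: std_free_simps)
            finally show ?thesis using a by (auto simp: lookup_homogeneous_part)
          next
            case False
            thus ?thesis using hom[OF False] by (auto simp: lookup_homogeneous_part)
          qed
        qed
        thus ?thesis using True by simp
      next
        case False
        thus ?thesis using c_carr[of a] by (auto simp: std_free_simps)
      qed
    qed
  qed
  show ?thesis
    unfolding is_graded_module_def using module_std_free sub smult dec by blast
qed


text \<open>
  Since \<open>J\<close> is finite, \<open>f\<close> is the finite sum of the multiples \<open>f\<^sub>j e\<^sub>j\<close> of the basis elements.
\<close>

lemma ideal_smult_std_freeI:
  fixes f :: "'j \<Rightarrow> ('n, 'k::field) mpoly"
  assumes f: "f \<in> carrier (std_free J \<beta>)" and I: "\<And>j. j \<in> J \<Longrightarrow> f j \<in> I"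
  shows "f \<in> ideal_smult I (std_free J \<beta>)"
proof -
  let ?F = "std_free J \<beta> :: ('n, 'k, _) graded_module"
  interpret F: module poly_ring ?F by (rule module_std_free)
  have gen: "(\<lambda>i\<in>J. if i = j then f j else 0) \<in> ideal_smult I ?F" if "j \<in> J" for j
  proof -
    have "(\<lambda>i\<in>J. if i = j then f j else 0) = f j \<odot>\<^bsub>?F\<^esub> std_basis J j"
      by (auto simp: std_free_simps std_basis_def fun_eq_iff)
    moreover have "std_basis J j \<in> carrier ?F" by (simp add: std_free_simps std_basis_def)
    ultimately show ?thesis
      unfolding ideal_smult_def using I[OF that] by (auto intro!: generate.incl)
  qed
  have add_closed: "x \<oplus>\<^bsub>?F\<^esub> y \<in> ideal_smult I ?F"
    if "x \<in> ideal_smult I ?F" "y \<in> ideal_smult I ?F" for x y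
    using generate.eng[of x "add_monoid ?F"] that by (simp add: ideal_smult_def)
  have partial: "(\<lambda>i\<in>J. if i \<in> S then f i else 0) \<in> ideal_smult I ?F" if "finite S" "S \<subseteq> J" for S
    using that
  proof (induction S rule: finite_induct)
    case empty
    show ?case
      using generate.one[of "add_monoid ?F" "{p \<odot>\<^bsub>?F\<^esub> x | p x. p \<in> I \<and> x \<in> carrier ?F}"]
      by (simp add: ideal_smult_def std_free_simps(3) restrict_def)
  next
    case (insert j S)
    have "(\<lambda>i\<in>J. if i \<in> insert j S then f i else 0) =
        (\<lambda>i\<in>J. if i = j then f j else 0) \<oplus>\<^bsub>?F\<^esub> (\<lambda>i\<in>J. if i \<in> S then f i else 0)"
      using insert.hyps by (auto simp: std_free_simps fun_eq_iff)
    moreover have "j \<in> J" "S \<subseteq> J" using insert.prems by auto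
    ultimately show ?case
      using add_closed[OF gen[of j] insert.IH] by metis
  qed
  have "f = (\<lambda>i\<in>J. if i \<in> J then f i else 0)"
    using f by (auto simp: std_free_simps fun_eq_iff)
  thus ?thesis using partial[OF fin subset_refl] by metis
qed

end

text \<open>
  The definition of \<open>graded_free\<close> asks for an index set inside the module itself. The standard basis
  is one: \<open>j \<mapsto> e\<^sub>j\<close> is injective, so the direct sum can be reindexed along it.
\<close>

lemma graded_free_std_free:
  fixes \<beta> :: "'j \<Rightarrow> 'n::finite degree"
  assumes fin: "finite J"
  shows "graded_free (std_free J \<beta> :: ('n, 'k::field, _) graded_module)"
proof -
  let ?F = "std_free J \<beta> :: ('n, 'k, _) graded_module"
  let ?b = "std_basis J :: 'j \<Rightarrow> 'j \<Rightarrow> ('n, 'k) mpoly"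
  let ?u = "inv_into J ?b"
  let ?G = "std_free (?b ` J) (\<beta> \<circ> ?u) :: ('n, 'k, _) graded_module"
  have u: "?u (?b j) = j" if "j \<in> J" for j
    using inv_into_f_f[OF inj_std_basis that] .
  note simps = std_free_simps[OF fin] std_free_simps[OF finite_imageI[OF fin]]
  let ?\<Phi> = "\<lambda>f. \<lambda>s\<in>?b ` J. f (?u s)"
  have "graded_hom ?F ?G ?\<Phi>"
    unfolding graded_hom_def simps by (auto simp: fun_eq_iff u)
  moreover have "bij_betw ?\<Phi> (carrier ?F) (carrier ?G)"
    by (rule bij_betwI[where g = "\<lambda>g. \<lambda>j\<in>J. g (?b j)"])
       (auto simp: simps fun_eq_iff u PiE_iff extensional_def)
  ultimately show ?thesis unfolding graded_free_def graded_iso_def by blast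
qed


section \<open>The homomorphism of a monomial matrix in coordinates\<close>

text \<open>
  At most one monomial of \<open>p\<close> moves degree \<open>e\<close> to degree \<open>d\<close>, namely the one of degree \<open>d - e\<close>.
\<close>

lemma dual_smult_single:
  "Poly_Mapping.lookup (dual_smult p (Poly_Mapping.single e c)) d =
     (if d \<le> 0 \<and> e \<le> d then Poly_Mapping.lookup p (expo (d - e)) * c else 0)"
proof (cases "c = 0")
  case True
  thus ?thesis by (simp add: dual_smult_def)
next
  case False
  have eq: "e + mdeg \<gamma> = d \<longleftrightarrow> e \<le> d \<and> \<gamma> = expo (d - e)" for \<gamma>
  proof -
    have "e + mdeg \<gamma> = d \<longleftrightarrow> mdeg \<gamma> = d - e" by (auto simp: algebra_simps)
    also have "\<dots> \<longleftrightarrow> 0 \<le> d - e \<and> \<gamma> = expo (d - e)" by (rule mdeg_eq_iff)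
    also have "0 \<le> d - e \<longleftrightarrow> e \<le> d" by (simp add: le_fun_def)
    finally show ?thesis .
  qed
  have keys: "Poly_Mapping.keys (Poly_Mapping.single e c) = {e}" using False by simp
  have "Poly_Mapping.lookup (dual_smult p (Poly_Mapping.single e c)) d =
      (\<Sum>\<gamma>\<in>Poly_Mapping.keys p. if e + mdeg \<gamma> = d then
         (if d \<le> 0 then Poly_Mapping.lookup p \<gamma> * c else 0) else 0)"
    unfolding dual_smult_def lookup_sum keys
    by (rule sum.cong) (auto simp: lookup_single when_def)
  also have "\<dots> = (\<Sum>\<gamma>\<in>Poly_Mapping.keys p. if \<gamma> = expo (d - e) then
         (if d \<le> 0 \<and> e \<le> d then Poly_Mapping.lookup p (expo (d - e)) * c else 0) else 0)"
    unfolding eq by (rule sum.cong) auto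
  also have "\<dots> = (if d \<le> 0 \<and> e \<le> d then Poly_Mapping.lookup p (expo (d - e)) * c else 0)"
    by (auto simp: in_keys_iff)
  finally show ?thesis .
qed

lemma dual_smult_0 [simp]: "dual_smult p 0 = 0"
  by (simp add: dual_smult_def)

text \<open>
  The coordinate \<open>i\<close> of \<open>\<phi>\<^sub>A(f)\<close> in degree \<open>g\<close>, an element of \<open>k\<close>: the term \<open>c X\<^sup>\<gamma> e\<^sub>j\<close> has degree \<open>g\<close> iff
  \<open>\<gamma> = g - \<beta>\<^sub>j\<close>, it is sent to \<open>c a\<^sub>i\<^sub>j\<close>, and the \<open>i\<close>-th summand of the cofree module vanishes in
  degree \<open>g\<close> unless \<open>g \<le> \<alpha>\<^sub>i\<close>. Polynomials enter only through their coefficients, which turns identities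
  between values of \<open>\<phi>\<^sub>A\<close> into identities between sums in \<open>k\<close>.
\<close>

definition image_coeff ::
  "('i, 'j, 'n, 'k::field) graded_matrix \<Rightarrow> ('j \<Rightarrow> ('n, 'k) mpoly) \<Rightarrow> 'i \<Rightarrow> 'n degree \<Rightarrow> 'k" where
  "image_coeff A f i g = (if g \<le> cogen_deg A i then
     \<Sum>j | j \<in> cols A \<and> gen_deg A j \<le> g.
       entry A i j * Poly_Mapping.lookup (f j) (expo (g - gen_deg A j))
     else 0)"

context
  fixes A :: "('i, 'j, 'n::finite, 'k::field) graded_matrix"
  assumes fin_rows: "finite (rows A)" and fin_cols: "finite (cols A)"
    and graded: "is_graded_module (cofree_of A)"
begin

lemma cofree_of_simps:
  "carrier (cofree_of A) =
     (\<Pi>\<^sub>E i\<in>rows A. {f. \<forall>a\<in>Poly_Mapping.keys f. a \<le> 0})"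
  "add (cofree_of A) = (\<lambda>x y. \<lambda>i\<in>rows A. x i + y i)"
  "ring.zero (cofree_of A) = (\<lambda>i\<in>rows A. 0)"
  "module.smult (cofree_of A) = (\<lambda>p x. \<lambda>i\<in>rows A. dual_smult p (x i))"
  using fin_rows
  by (auto simp: cofree_of_def std_cofree_def direct_sum_def shift_def dual_regular_module_def)

lemma gen_image_in_carrier: "gen_image A j \<in> carrier (cofree_of A)"
  by (auto simp: cofree_of_simps gen_image_def le_fun_def)

lemma matrix_hom_in_carrier: "matrix_hom A f \<in> carrier (cofree_of A)"
  and matrix_hom_eq:
    "matrix_hom A f = (\<lambda>i\<in>rows A. \<Sum>j\<in>cols A. dual_smult (f j) (gen_image A j i))"
proof -
  interpret E: module poly_ring "cofree_of A"
    using graded by (simp add: is_graded_module_def)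
  have sm: "f j \<odot>\<^bsub>cofree_of A\<^esub> gen_image A j \<in> carrier (cofree_of A)" for j
    by (rule E.smult_closed) (simp_all add: gen_image_in_carrier)
  show "matrix_hom A f \<in> carrier (cofree_of A)"
    unfolding matrix_hom_def by (rule E.finsum_closed) (use sm in auto)
  show "matrix_hom A f = (\<lambda>i\<in>rows A. \<Sum>j\<in>cols A. dual_smult (f j) (gen_image A j i))"
    unfolding matrix_hom_def
    by (subst finsum_coordinatewise[OF E.abelian_monoid_axioms])
       (use sm fin_cols in \<open>auto simp: cofree_of_simps(2-4) fun_eq_iff\<close>)
qed

text \<open>
  Degree \<open>g\<close> of the dual of the ring shifted by \<open>\<alpha>\<^sub>i\<close> is degree \<open>g - \<alpha>\<^sub>i\<close> of the dual itself.
\<close>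

lemma lookup_matrix_hom:
  assumes "i \<in> rows A"
  shows "Poly_Mapping.lookup (matrix_hom A f i) (g - cogen_deg A i) = image_coeff A f i g"
proof -
  let ?\<alpha> = "cogen_deg A i" and ?\<beta> = "gen_deg A"
  have "Poly_Mapping.lookup (dual_smult (f j) (gen_image A j i)) (g - ?\<alpha>) =
      (if ?\<beta> j \<le> g then if g \<le> ?\<alpha> then
         entry A i j * Poly_Mapping.lookup (f j) (expo (g - ?\<beta> j)) else 0 else 0)" for j
  proof -
    have *: "g - ?\<alpha> \<le> 0 \<longleftrightarrow> g \<le> ?\<alpha>" "?\<beta> j - ?\<alpha> \<le> g - ?\<alpha> \<longleftrightarrow> ?\<beta> j \<le> g"
      by (auto simp: le_fun_def)
    show ?thesis
      using assms
      by (auto simp: gen_image_def dual_smult_single *  dest: order_trans)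
  qed
  hence "Poly_Mapping.lookup (matrix_hom A f i) (g - ?\<alpha>) =
      (\<Sum>j\<in>cols A. if ?\<beta> j \<le> g then if g \<le> ?\<alpha> then
         entry A i j * Poly_Mapping.lookup (f j) (expo (g - ?\<beta> j)) else 0 else 0)"
    using assms by (simp add: matrix_hom_eq lookup_sum)
  also have "\<dots> = image_coeff A f i g"
    unfolding image_coeff_def by (subst sum.inter_filter[OF fin_cols]) (auto intro: sum.cong sum.neutral)
  finally show ?thesis .
qed

lemma matrix_hom_eqI:
  assumes x: "x \<in> carrier (cofree_of A)"
    and eq: "\<And>i g. i \<in> rows A \<Longrightarrow> Poly_Mapping.lookup (x i) (g - cogen_deg A i) = image_coeff A f i g"
  shows "x = matrix_hom A f"
proof (rule extensionalityI[of _ "rows A"])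
  show "x \<in> extensional (rows A)" "matrix_hom A f \<in> extensional (rows A)"
    using x matrix_hom_in_carrier[of f] by (auto simp: cofree_of_simps PiE_iff)
  fix i assume i: "i \<in> rows A"
  show "x i = matrix_hom A f i"
  proof (rule poly_mapping_eqI)
    fix d
    show "Poly_Mapping.lookup (x i) d = Poly_Mapping.lookup (matrix_hom A f i) d"
      using eq[OF i, of "d + cogen_deg A i"] lookup_matrix_hom[OF i, of f "d + cogen_deg A i"]
      by simp
  qed
qed

end


section \<open>Removing a column\<close>

lemma remove_col_simps [simp]:
  "rows (remove_col j A) = rows A" "cols (remove_col j A) = cols A - {j}"
  "entry (remove_col j A) = entry A"
  "cogen_deg (remove_col j A) = cogen_deg A" "gen_deg (remove_col j A) = gen_deg A"
  "cofree_of (remove_col j A) = cofree_of A"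
  by (simp_all add: remove_col_def cofree_of_def)

lemma monomial_matrix_remove_col: "monomial_matrix A \<Longrightarrow> monomial_matrix (remove_col j A)"
  by (auto simp: monomial_matrix_def)

lemma matrix_hom_remove_col:
  assumes fin: "finite (rows A)" "finite (cols A)" and graded: "is_graded_module (cofree_of A)"
    and fh: "\<And>j'. j' \<in> cols A - {j} \<Longrightarrow> h j' = f j'" and hj: "j \<in> cols A \<Longrightarrow> h j = 0"
  shows "matrix_hom (remove_col j A) f = matrix_hom A h"
proof (rule matrix_hom_eqI[OF fin graded])
  have fin': "finite (rows (remove_col j A))" "finite (cols (remove_col j A))"
    "is_graded_module (cofree_of (remove_col j A))"
    using fin graded by auto
  show "matrix_hom (remove_col j A) f \<in> carrier (cofree_of A)"
    using matrix_hom_in_carrier[OF fin'] by simp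
  fix i g assume "i \<in> rows A"
  hence "Poly_Mapping.lookup (matrix_hom (remove_col j A) f i) (g - cogen_deg A i) =
      image_coeff (remove_col j A) f i g"
    using lookup_matrix_hom[OF fin'] by simp
  also have "\<dots> = image_coeff A h i g"
    using fin(2) fh hj by (auto simp: image_coeff_def intro!: sum.mono_neutral_cong_left)
  finally show "Poly_Mapping.lookup (matrix_hom (remove_col j A) f i) (g - cogen_deg A i) =
      image_coeff A h i g" .
qed

lemma graded_hom_comp:
  "graded_hom L M g \<Longrightarrow> graded_hom M N f \<Longrightarrow> graded_hom L N (f \<circ> g)"
  unfolding graded_hom_def by (auto simp: Pi_iff image_subset_iff)

text \<open>
  The smaller free module embeds into the larger one by extension with zero, and \<open>\<phi>\<close> of the smaller
  matrix is the restriction of \<open>\<phi>\<^sub>A\<close> along this embedding.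
\<close>

lemma graded_hom_remove_col:
  assumes fin: "finite (rows A)" "finite (cols A)" and graded: "is_graded_module (cofree_of A)"
    and hom: "graded_hom (free_of A) (cofree_of A) (matrix_hom A)"
  shows "graded_hom (free_of (remove_col j A)) (cofree_of A) (matrix_hom (remove_col j A))"
proof -
  let ?h = "\<lambda>f. \<lambda>j'\<in>cols A. if j' = j then 0 else f j'"
  have fin': "finite (cols A - {j})" using fin by simp
  note simps = std_free_simps[OF fin(2)] std_free_simps[OF fin']
  have mh: "matrix_hom (remove_col j A) = matrix_hom A \<circ> ?h"
  proof
    fix f
    show "matrix_hom (remove_col j A) f = (matrix_hom A \<circ> ?h) f"
      unfolding comp_apply by (rule matrix_hom_remove_col[OF fin graded]) auto
  qed
  have "graded_hom (std_free (cols A - {j}) (gen_deg A)) (std_free (cols A) (gen_deg A)) ?h"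
    unfolding graded_hom_def simps
  proof (intro conjI ballI allI image_subsetI)
    fix a x
    assume "x \<in> (\<Pi>\<^sub>E j'\<in>cols A - {j}. poly_comp (a - gen_deg A j'))"
    hence "x j' \<in> poly_comp (a - gen_deg A j')" if "j' \<in> cols A" "j' \<noteq> j" for j'
      using that by blast
    thus "?h x \<in> (\<Pi>\<^sub>E j'\<in>cols A. poly_comp (a - gen_deg A j'))" by simp
  qed (simp_all add: fun_eq_iff)
  hence "graded_hom (free_of (remove_col j A)) (free_of A) ?h"
    by (simp add: free_of_def)
  thus ?thesis
    unfolding mh using hom by (rule graded_hom_comp)
qed

text \<open>
  The rows \<open>i\<close> for which \<open>\<beta>\<^sub>j \<le> \<alpha>\<^sub>i\<close> fails are zero both in the truncation and, for a monomial matrix, in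
  the column \<open>j\<close>; they impose no condition.
\<close>

lemma solution_set_trunc:
  assumes "monomial_matrix A" and "j \<in> cols A"
  shows "x \<in> solution_set (trunc A j) (\<lambda>i. entry A i j) \<longleftrightarrow>
    x \<in> ({j' \<in> cols A. gen_deg A j' \<le> gen_deg A j} - {j}) \<rightarrow>\<^sub>E UNIV \<and>
    (\<forall>i\<in>rows A. gen_deg A j \<le> cogen_deg A i \<longrightarrow>
       (\<Sum>j'\<in>{j' \<in> cols A. gen_deg A j' \<le> gen_deg A j} - {j}. entry A i j' * x j') = entry A i j)"
    (is "_ \<longleftrightarrow> x \<in> ?T \<rightarrow>\<^sub>E UNIV \<and> ?R")
proof -
  have "(\<Sum>j'\<in>?T. entry (trunc A j) i j' * x j') = entry A i j \<longleftrightarrow>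
      (gen_deg A j \<le> cogen_deg A i \<longrightarrow> (\<Sum>j'\<in>?T. entry A i j' * x j') = entry A i j)"
    if "i \<in> rows A" for i
    using assms that
    by (cases "gen_deg A j \<le> cogen_deg A i") (simp_all add: trunc_def monomial_matrix_def)
  thus ?thesis by (simp add: solution_set_def trunc_def)
qed

text \<open>
  Given \<open>f\<close>, the substitution \<open>e\<^sub>j \<mapsto> \<Sum>\<^sub>l x\<^sub>l X\<^bsup>\<beta>\<^sub>j - \<beta>\<^sub>l\<^esup> e\<^sub>l\<close> yields an element of the smaller free module with
  the same image, because \<open>x\<close> solves the system.
\<close>

lemma image_remove_col:
  fixes A :: "('i, 'j, 'n::finite, 'k::field) graded_matrix"
  assumes mono: "monomial_matrix A" and graded: "is_graded_module (cofree_of A)"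
    and j: "j \<in> cols A" and x: "x \<in> solution_set (trunc A j) (\<lambda>i. entry A i j)"
  shows "matrix_hom (remove_col j A) ` carrier (free_of (remove_col j A)) =
    matrix_hom A ` carrier (free_of A)"
proof -
  have fin: "finite (rows A)" "finite (cols A)" using mono by (auto simp: monomial_matrix_def)
  hence fin': "finite (cols A - {j})" by simp
  note simps = std_free_simps[OF fin(2)] std_free_simps[OF fin']
  let ?\<beta> = "gen_deg A"
  let ?T = "{j' \<in> cols A. ?\<beta> j' \<le> ?\<beta> j} - {j}"
  have sol: "(\<Sum>j'\<in>?T. entry A i j' * x j') = entry A i j" if "i \<in> rows A" "?\<beta> j \<le> cogen_deg A i" for i
    using x that unfolding solution_set_trunc[OF mono j] by blast
  show ?thesis
  proof (intro equalityI image_subsetI)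
    fix f :: "'j \<Rightarrow> ('n, 'k) mpoly" assume f: "f \<in> carrier (free_of (remove_col j A))"
    let ?h = "\<lambda>j'\<in>cols A. if j' = j then 0 else f j'"
    have "matrix_hom (remove_col j A) f = matrix_hom A ?h"
      by (rule matrix_hom_remove_col[OF fin graded]) auto
    moreover have "?h \<in> carrier (free_of A)" by (simp add: free_of_def simps)
    ultimately show "matrix_hom (remove_col j A) f \<in> matrix_hom A ` carrier (free_of A)" by blast
  next
    fix f :: "'j \<Rightarrow> ('n, 'k) mpoly" assume f: "f \<in> carrier (free_of A)"
    define m where "m j' = f j * Poly_Mapping.single (expo (?\<beta> j - ?\<beta> j')) (x j')" for j'
    define h where "h = (\<lambda>j'\<in>cols A - {j}. f j' + (if ?\<beta> j' \<le> ?\<beta> j then m j' else 0))"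
    let ?h = "\<lambda>j'. if j' = j then 0 else h j'"
    let ?L = "\<lambda>p g j'. Poly_Mapping.lookup p (expo (g - ?\<beta> j'))"
    have "matrix_hom A f = matrix_hom A ?h"
    proof (rule matrix_hom_eqI[OF fin graded])
      show "matrix_hom A f \<in> carrier (cofree_of A)" by (rule matrix_hom_in_carrier[OF fin graded])
      fix i g assume i: "i \<in> rows A"
      have "image_coeff A f i g = image_coeff A ?h i g"
      proof (cases "g \<le> cogen_deg A i")
        case g: True
        let ?S = "{j' \<in> cols A. ?\<beta> j' \<le> g}"
        have finS: "finite ?S" using fin by simp
        have m: "?L (m j') g j' = (if ?\<beta> j \<le> g then ?L (f j) g j * x j' else 0)"
          if "?\<beta> j' \<le> ?\<beta> j" "?\<beta> j' \<le> g" for j'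
        proof -
          have le: "?\<beta> j' l \<le> ?\<beta> j l" "?\<beta> j' l \<le> g l" for l
            using that by (simp_all add: le_fun_def)
          have "expo (?\<beta> j - ?\<beta> j') l \<le> expo (g - ?\<beta> j') l \<longleftrightarrow> ?\<beta> j l \<le> g l" for l
            using le[of l] by auto
          hence 1: "expo (?\<beta> j - ?\<beta> j') \<le> expo (g - ?\<beta> j') \<longleftrightarrow> ?\<beta> j \<le> g"
            unfolding le_fun_def by blast
          have "expo (g - ?\<beta> j') l - expo (?\<beta> j - ?\<beta> j') l = expo (g - ?\<beta> j) l"
            if "?\<beta> j \<le> g" for l
            using le[of l] le_funD[OF that, of l] by auto
          hence 2: "(\<lambda>i. expo (g - ?\<beta> j') i - expo (?\<beta> j - ?\<beta> j') i) = expo (g - ?\<beta> j)"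
            if "?\<beta> j \<le> g"
            using that by blast
          show ?thesis unfolding m_def lookup_times_single 1 using 2 by auto
        qed
        have T: "?T \<inter> ?S = ?T" if "?\<beta> j \<le> g" using that by (auto dest: order_trans)
        \<comment> \<open>All that was added to the coordinates other than \<open>j\<close> makes up for the lost term at \<open>j\<close>.\<close>
        have extra: "(\<Sum>j'\<in>?S. if j' \<in> ?T then entry A i j' * ?L (m j') g j' else 0) =
            (if j \<in> ?S then entry A i j * ?L (f j) g j else 0)"
        proof (cases "?\<beta> j \<le> g")
          case True
          have "(\<Sum>j'\<in>?S. if j' \<in> ?T then entry A i j' * ?L (m j') g j' else 0) =
              (\<Sum>j'\<in>?S. if j' \<in> ?T then entry A i j' * x j' * ?L (f j) g j else 0)"
            using m True by (auto intro!: sum.cong)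
          also have "\<dots> = (\<Sum>j'\<in>?S \<inter> ?T. entry A i j' * x j' * ?L (f j) g j)"
            by (rule sum.inter_restrict[OF finS, symmetric])
          also have "\<dots> = (\<Sum>j'\<in>?T. entry A i j' * x j') * ?L (f j) g j"
            using T[OF True] by (simp add: sum_distrib_right Int_commute)
          also have "\<dots> = entry A i j * ?L (f j) g j"
            using sol[OF i order_trans[OF True g]] by simp
          finally show ?thesis using j True by simp
        next
          case False
          thus ?thesis using m by (auto intro!: sum.neutral)
        qed
        have "(\<Sum>j'\<in>?S. entry A i j' * ?L (?h j') g j') =
            (\<Sum>j'\<in>?S. (if j' = j then 0 else entry A i j' * ?L (f j') g j') +
               (if j' \<in> ?T then entry A i j' * ?L (m j') g j' else 0))"
          by (rule sum.cong) (auto simp: h_def lookup_add algebra_simps)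
        also have "\<dots> = (\<Sum>j'\<in>?S. if j' = j then 0 else entry A i j' * ?L (f j') g j') +
            (\<Sum>j'\<in>?S. if j' = j then entry A i j * ?L (f j) g j else 0)"
          unfolding sum.distrib extra using finS by simp
        also have "\<dots> = (\<Sum>j'\<in>?S. entry A i j' * ?L (f j') g j')"
          unfolding sum.distrib[symmetric] by (rule sum.cong) auto
        finally show ?thesis using g by (simp add: image_coeff_def)
      qed (simp add: image_coeff_def)
      thus "Poly_Mapping.lookup (matrix_hom A f i) (g - cogen_deg A i) = image_coeff A ?h i g"
        using lookup_matrix_hom[OF fin graded i] by simp
    qed
    also have "\<dots> = matrix_hom (remove_col j A) h"
      by (rule matrix_hom_remove_col[OF fin graded, symmetric]) auto
    finally have "matrix_hom A f = matrix_hom (remove_col j A) h" .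
    moreover have "h \<in> carrier (free_of (remove_col j A))"
      by (simp add: free_of_def simps h_def)
    ultimately show "matrix_hom A f \<in> matrix_hom (remove_col j A) ` carrier (free_of (remove_col j A))"
      by blast
  qed
qed

lemma represents_presentation_remove_col:
  fixes A :: "('i, 'j, 'n::finite, 'k::field) graded_matrix"
  assumes mono: "monomial_matrix A" and rep: "represents_presentation A M"
    and j: "j \<in> cols A" and x: "x \<in> solution_set (trunc A j) (\<lambda>i. entry A i j)"
  shows "represents_presentation (remove_col j A) M"
proof -
  have fin: "finite (rows A)" "finite (cols A)" using mono by (auto simp: monomial_matrix_def)
  hence fin': "finite (cols A - {j})" by simp
  note rep = rep[unfolded represents_presentation_def free_cofree_presentation_def]
  have "image_module (free_of (remove_col j A)) (cofree_of A) (matrix_hom (remove_col j A)) =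
      image_module (free_of A) (cofree_of A) (matrix_hom A)"
    using image_remove_col[OF mono _ j x] rep by (simp add: image_module_def)
  moreover have "is_graded_module (free_of (remove_col j A))" "graded_free (free_of (remove_col j A))"
    using graded_std_free[OF fin'] graded_free_std_free[OF fin'] by (simp_all add: free_of_def)
  moreover have "graded_hom (free_of (remove_col j A)) (cofree_of A) (matrix_hom (remove_col j A))"
    using graded_hom_remove_col[OF fin] rep by blast
  ultimately show ?thesis
    using rep by (simp add: represents_presentation_def free_cofree_presentation_def)
qed


section \<open>Generator-minimality\<close>

text \<open>
  A solution that uses fewer columns is extended by zero. By contraposition, a column that
  could not be removed at its turn cannot be removed after later removals either.
\<close>

lemma solution_set_remove_col:
  assumes fin: "finite (cols A)" and ne: "solution_set (trunc (remove_col l A) j) b \<noteq> {}"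
  shows "solution_set (trunc A j) b \<noteq> {}"
proof -
  let ?C = "cols (trunc A j)" and ?C' = "cols (trunc (remove_col l A) j)"
  obtain x where x: "x \<in> solution_set (trunc (remove_col l A) j) b" using ne by blast
  let ?x = "\<lambda>j'\<in>?C. if j' = l then 0 else x j'"
  have "(\<Sum>j'\<in>?C. entry (trunc A j) i j' * ?x j') =
      (\<Sum>j'\<in>?C'. entry (trunc (remove_col l A) j) i j' * x j')" for i
    using fin by (intro sum.mono_neutral_cong_right) (auto simp: trunc_def)
  hence "?x \<in> solution_set (trunc A j) b"
    using x by (auto simp: solution_set_def) (simp_all add: trunc_def)
  thus ?thesis by blast
qed

text \<open>
  A nonzero constant coefficient \<open>c\<close> of \<open>f\<^sub>j\<close>, for \<open>f\<close> in the kernel, would give a solution at \<open>j\<close>: in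
  degree \<open>\<beta>\<^sub>j\<close> the equation \<open>\<phi>\<^sub>A(f) = 0\<close> reads \<open>c a\<^sub>i\<^sub>j + \<Sum>\<^sub>l y\<^sub>l a\<^sub>i\<^sub>l = 0\<close> for the rows with \<open>\<beta>\<^sub>j \<le> \<alpha>\<^sub>i\<close>, where
  \<open>y\<^sub>l\<close> is the coefficient of \<open>X\<^bsup>\<beta>\<^sub>j - \<beta>\<^sub>l\<^esup>\<close> in \<open>f\<^sub>l\<close>, so \<open>- y\<^sub>l / c\<close> is a solution.
\<close>

lemma generator_minimal_matrixI:
  fixes A :: "('i, 'j, 'n::finite, 'k::field) graded_matrix"
  assumes mono: "monomial_matrix A" and graded: "is_graded_module (cofree_of A)"
    and unsolvable: "\<And>j. j \<in> cols A \<Longrightarrow> solution_set (trunc A j) (\<lambda>i. entry A i j) = {}"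
  shows "generator_minimal_matrix A"
  unfolding generator_minimal_matrix_def generator_minimal_def
proof
  fix f assume f: "f \<in> a_kernel (free_of A) (cofree_of A) (matrix_hom A)"
  have fin: "finite (rows A)" "finite (cols A)" using mono by (auto simp: monomial_matrix_def)
  have f_carr: "f \<in> carrier (std_free (cols A) (gen_deg A))"
    and f_ker: "matrix_hom A f = (\<lambda>i\<in>rows A. 0)"
    using f by (auto simp: a_kernel_def' free_of_def cofree_of_simps[OF fin graded])
  have image_coeff: "image_coeff A f i g = 0" if "i \<in> rows A" for i g
    using lookup_matrix_hom[OF fin graded that, of f g] that by (simp add: f_ker)
  have "Poly_Mapping.lookup (f j) 0 = 0" if j: "j \<in> cols A" for j
  proof (rule ccontr)
    let ?\<beta> = "gen_deg A"
    let ?T = "{j' \<in> cols A. ?\<beta> j' \<le> ?\<beta> j} - {j}"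
    let ?y = "\<lambda>j'. Poly_Mapping.lookup (f j') (expo (?\<beta> j - ?\<beta> j'))"
    let ?c = "Poly_Mapping.lookup (f j) 0"
    assume c: "?c \<noteq> 0"
    have yj: "?y j = ?c" by (simp add: zero_fun_def)
    let ?x = "\<lambda>j'\<in>?T. - ?y j' / ?c"
    have "(\<Sum>j'\<in>?T. entry A i j' * (- ?y j' / ?c)) = entry A i j"
      if i: "i \<in> rows A" and le: "?\<beta> j \<le> cogen_deg A i" for i
    proof -
      let ?S = "{j' \<in> cols A. ?\<beta> j' \<le> ?\<beta> j}"
      have "(\<Sum>j'\<in>?S. entry A i j' * ?y j') = 0"
        using image_coeff[OF i, of "?\<beta> j"] le by (simp only: image_coeff_def if_True)
      moreover have "(\<Sum>j'\<in>?S. entry A i j' * ?y j') =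
          entry A i j * ?y j + (\<Sum>j'\<in>?T. entry A i j' * ?y j')"
        by (rule sum.remove) (use fin(2) j in auto)
      ultimately have "0 = entry A i j * ?y j + (\<Sum>j'\<in>?T. entry A i j' * ?y j')" by metis
      hence "(\<Sum>j'\<in>?T. entry A i j' * ?y j') = - (entry A i j * ?c)"
        unfolding yj by (simp add: eq_neg_iff_add_eq_0 add.commute)
      moreover have "(\<Sum>j'\<in>?T. entry A i j' * (- ?y j' / ?c)) = - (\<Sum>j'\<in>?T. entry A i j' * ?y j') / ?c"
        by (simp add: sum_divide_distrib sum_negf)
      ultimately show ?thesis using c by simp
    qed
    hence "?x \<in> solution_set (trunc A j) (\<lambda>i. entry A i j)"
      unfolding solution_set_trunc[OF mono j] by simp
    thus False using unsolvable[OF j] by blast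
  qed
  hence "f j \<in> irrelevant_ideal" if "j \<in> cols A" for j
    using that by (blast intro: irrelevant_idealI)
  thus "f \<in> ideal_smult irrelevant_ideal (free_of A)"
    unfolding free_of_def by (rule ideal_smult_std_freeI[OF fin(2) f_carr])
qed


section \<open>The procedure\<close>

text \<open>
  The last hypothesis, on the columns no longer waiting in \<open>js\<close>, is what makes the induction
  go through: the columns already treated and kept stay irredundant.
\<close>

lemma reduce_invariant:
  fixes A :: "('i, 'j, 'n::finite, 'k::field) graded_matrix"
  assumes "monomial_matrix A" and "represents_presentation A M"
    and "distinct js" and "set js \<subseteq> cols A"
    and "\<And>j. j \<in> cols A - set js \<Longrightarrow> solution_set (trunc A j) (\<lambda>i. entry A i j) = {}"
  shows "monomial_matrix (reduce js A) \<and> represents_presentation (reduce js A) M \<and>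
    (\<forall>j\<in>cols (reduce js A).
       solution_set (trunc (reduce js A) j) (\<lambda>i. entry (reduce js A) i j) = {})"
  using assms
proof (induction js arbitrary: A)
  case Nil
  thus ?case by (simp add: reduce_def)
next
  case (Cons j js)
  have red: "reduce (j # js) A = reduce js (reduce_step j A)" by (simp add: reduce_def)
  show ?case
  proof (cases "solution_set (trunc A j) (\<lambda>i. entry A i j) = {}")
    case True
    thus ?thesis
      unfolding red using Cons.prems by (intro Cons.IH) (auto simp: reduce_step_def)
  next
    case False
    then obtain x where x: "x \<in> solution_set (trunc A j) (\<lambda>i. entry A i j)" by blast
    have "finite (cols A)" using Cons.prems(1) by (simp add: monomial_matrix_def)
    note mono = solution_set_remove_col[OF this]
    have "reduce_step j A = remove_col j A" using False by (simp add: reduce_step_def)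
    moreover have "represents_presentation (remove_col j A) M"
      using Cons.prems x by (intro represents_presentation_remove_col) auto
    moreover have "solution_set (trunc (remove_col j A) l) (\<lambda>i. entry (remove_col j A) i l) = {}"
      if "l \<in> cols (remove_col j A) - set js" for l
      using Cons.prems(5)[of l] that mono[of j l "\<lambda>i. entry A i l"] by auto
    ultimately show ?thesis
      unfolding red using Cons.prems by (intro Cons.IH) (auto simp: monomial_matrix_remove_col)
  qed
qed

theorem mainTheorem3:
  fixes A :: "('i, 'j, 'n::finite, 'k::field) graded_matrix"
    and M :: "('n, 'k, 'm) graded_module"
    and js :: "'j list"
  assumes "monomial_matrix A"
    and "represents_presentation A M"
    and "distinct js" and "set js = cols A"
  shows "monomial_matrix (reduce js A) \<and>
         represents_presentation (reduce js A) M \<and>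
         generator_minimal_matrix (reduce js A)"
proof -
  have *: "monomial_matrix (reduce js A) \<and> represents_presentation (reduce js A) M \<and>
    (\<forall>j\<in>cols (reduce js A).
       solution_set (trunc (reduce js A) j) (\<lambda>i. entry (reduce js A) i j) = {})"
    by (rule reduce_invariant) (use assms in auto)
  hence "is_graded_module (cofree_of (reduce js A))"
    by (simp add: represents_presentation_def free_cofree_presentation_def)
  thus ?thesis using * by (auto intro: generator_minimal_matrixI)
qed

end
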